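(* Fix integers $n,d,k\ge1$. For each layer $l\ge0$ let $\alpha^V_l,\alpha^Q_l,\alpha^K_l,\alpha^R_l$ be scalars and $W^{V,\Phi}_l,W^{Q,\Phi}_l,W^{K,\Phi}_l,W^{R,\Phi}_l\in\mathbb{R}^{2k\times2k}$. For $B\in\mathbb{R}^{n\times d}$ and $\Phi\in\mathbb{R}^{n\times 2k}$ define $B_0=B$, $\Phi_0=\Phi$ and $$B_{l+1}^\top=(1+\alpha^R_l)B_l^\top+\alpha^V_l B_l^\top\left(\alpha^Q_l\alpha^K_l B_lB_l^\top+\Phi_l (W^{Q,\Phi}_l)^\top W^{K,\Phi}_l\Phi_l^\top\right),$$ $$\Phi_{l+1}^\top=(I+W^{R,\Phi}_l)\Phi_l^\top+W^{V,\Phi}_l\Phi_l^\top\left(\alpha^Q_l\alpha^K_l B_lB_l^\top+\Phi_l (W^{Q,\Phi}_l)^\top W^{K,\Phi}_l\Phi_l^\top\right).$$ Let $\mathrm{TF}^B_l(B,\Phi):=B_l^\top$ and $\mathrm{TF}^\Phi_l(B,\Phi):=\Phi_l^\top$. Then for every permutation matrix $U\in\mathbb{R}^{d\times d}$ and every layer $l$, $$\mathrm{TF}^B_l(BU,\Phi)=U^\top\,\mathrm{TF}^B_l(B,\Phi),\qquad \mathrm{TF}^\Phi_l(BU,\Phi)=\mathrm{TF}^\Phi_l(B,\Phi).$$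
   Context: Here $B$ plays the role of a graph incidence matrix with $n$ vertices and $d$ edges, and right-multiplication by a permutation matrix $U\in\mathbb{R}^{d\times d}$ permutes the edge indices. *)

theory Defs
  imports "HOL-Analysis.Analysis"
begin

text \<open>A permutation matrix: the matrix with entry (i,j) equal to 1 iff p i = j,
  for a permutation p of the index set.\<close>
definition permutation_matrix :: "real^'d^'d \<Rightarrow> bool" where
  "permutation_matrix U \<longleftrightarrow>
     (\<exists>p. p permutes (UNIV :: 'd set) \<and> U = (\<chi> i j. if p i = j then 1 else 0))"

text \<open>The layer recursion. B :: n x d (real^'d^'n), Phi :: n x 2k (real^'m^'n).
  TF l B Phi returns the pair (B_l^T, Phi_l^T).\<close>
fun TF :: "(nat \<Rightarrow> real) \<Rightarrow> (nat \<Rightarrow> real) \<Rightarrow> (nat \<Rightarrow> real) \<Rightarrow> (nat \<Rightarrow> real) \<Rightarrow>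
           (nat \<Rightarrow> real^'m^'m) \<Rightarrow> (nat \<Rightarrow> real^'m^'m) \<Rightarrow> (nat \<Rightarrow> real^'m^'m) \<Rightarrow> (nat \<Rightarrow> real^'m^'m) \<Rightarrow>
           nat \<Rightarrow> real^'d^'n \<Rightarrow> real^'m^'n \<Rightarrow> ((real^'n^'d) \<times> (real^'n^'m))" where
  "TF aV aQ aK aR WV WQ WK WR 0 B Phi = (transpose B, transpose Phi)"
| "TF aV aQ aK aR WV WQ WK WR (Suc l) B Phi =
     (let (BT, PT) = TF aV aQ aK aR WV WQ WK WR l B Phi;
          A = (aQ l * aK l) *\<^sub>R (transpose BT ** BT)
              + transpose PT ** transpose (WQ l) ** WK l ** PT
      in ((1 + aR l) *\<^sub>R BT + aV l *\<^sub>R (BT ** A),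
          (mat 1 + WR l) ** PT + WV l ** PT ** A))"

definition TF_B where "TF_B aV aQ aK aR WV WQ WK WR l B Phi = fst (TF aV aQ aK aR WV WQ WK WR l B Phi)"
definition TF_Phi where "TF_Phi aV aQ aK aR WV WQ WK WR l B Phi = snd (TF aV aQ aK aR WV WQ WK WR l B Phi)"

end

theory Submission
  imports Defs
begin

text \<open>Right multiplication by an orthogonal matrix U leaves the Gram matrix
  B B^T unchanged. Hence, inductively, replacing B by BU turns B_l into B_l U while
  Phi_l and the attention matrix of every layer stay the same. Permutation matrices
  are orthogonal.\<close>

lemma permutation_matrix_orthogonal:
  assumes "permutation_matrix (U :: real^'d^'d)"
  shows "orthogonal_matrix U"
proof -
  obtain p where p: "p permutes (UNIV :: 'd set)"
    and U: "U = (\<chi> i j. if p i = j then 1 else 0)"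
    using assms unfolding permutation_matrix_def by blast
  have rows: "row i U = axis (p i) 1" for i
    by (simp add: U row_def axis_def vec_eq_iff eq_commute)
  have "U ** transpose U = mat 1"
    unfolding matrix_mult_transpose_dot_row rows
    by (simp add: inner_axis_axis mat_def vec_eq_iff permutes_inj[OF p, THEN inj_eq])
  then show ?thesis
    by (metis orthogonal_matrix orthogonal_matrix_transpose transpose_transpose)
qed

lemma orthogonal_matrix_gram_transpose_mult:
  fixes U :: "real^'d^'d" and X :: "real^'n^'d"
  assumes "orthogonal_matrix U"
  shows "transpose (transpose U ** X) ** (transpose U ** X) = transpose X ** X"
proof -
  have "transpose (transpose U ** X) ** (transpose U ** X) = transpose X ** (U ** transpose U) ** X"
    by (simp add: matrix_transpose_mul matrix_mul_assoc)
  also have "\<dots> = transpose X ** X"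
    using assms by (simp add: orthogonal_matrix_def)
  finally show ?thesis .
qed

lemma TF_mult_orthogonal:
  assumes "orthogonal_matrix U"
  shows "TF aV aQ aK aR WV WQ WK WR l (B ** U) Phi
           = apfst ((**) (transpose U)) (TF aV aQ aK aR WV WQ WK WR l B Phi)"
proof (induction l)
  case 0
  then show ?case by (simp add: matrix_transpose_mul)
next
  case (Suc l)
  obtain BT PT where layer: "TF aV aQ aK aR WV WQ WK WR l B Phi = (BT, PT)"
    by fastforce
  with Suc have layer_mult: "TF aV aQ aK aR WV WQ WK WR l (B ** U) Phi = (transpose U ** BT, PT)"
    by simp
  show ?case
    unfolding TF.simps layer layer_mult Let_def prod.case
      orthogonal_matrix_gram_transpose_mult[OF assms]
    by (simp add: matrix_add_ldistrib scaleR_add_right matrix_scalar_ac scalar_matrix_assoc matrix_mul_assoc)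
qed

theorem lemma9:
  fixes aV aQ aK aR :: "nat \<Rightarrow> real"
    and WV WQ WK WR :: "nat \<Rightarrow> real^'m^'m"
    and B :: "real^'d^'n" and Phi :: "real^'m^'n"
    and U :: "real^'d^'d" and l :: nat
  assumes "even CARD('m)"
    and "permutation_matrix U"
  shows "TF_B aV aQ aK aR WV WQ WK WR l (B ** U) Phi
           = transpose U ** TF_B aV aQ aK aR WV WQ WK WR l B Phi
         \<and> TF_Phi aV aQ aK aR WV WQ WK WR l (B ** U) Phi
           = TF_Phi aV aQ aK aR WV WQ WK WR l B Phi"
  unfolding TF_B_def TF_Phi_def
    TF_mult_orthogonal[OF permutation_matrix_orthogonal[OF assms(2)]]
  by simp

end
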